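(* For each positive integer $k$, there exists a connected graph $G$ with $\gamma_k(G)=\dim_k(G)+1$.
   Context: All graphs are finite, simple, undirected, connected and of order at least $2$. $d(x,y)$ is the length of a shortest path between $x$ and $y$ in $G$. For a positive integer $k$, let $d_k(x,y)=\min\{d(x,y),k+1\}$. A set $D\subseteq V(G)$ is a distance-$k$ dominating set of $G$ if for each $u\in V(G)\setminus D$ there is $w\in D$ with $d(u,w)\le k$; the distance-$k$ domination number $\gamma_k(G)$ is the minimum cardinality of a distance-$k$ dominating set. A set $S\subseteq V(G)$ is a distance-$k$ resolving set of $G$ if for any distinct $x,y\in V(G)$ there is $z\in S$ with $d_k(x,z)\ne d_k(y,z)$; the distance-$k$ dimension $\dim_k(G)$ is the minimum cardinality of a distance-$k$ resolving set. *)

theory Defs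
  imports "Graph_Theory.Graph_Theory"
begin

text \<open>
  A finite simple undirected graph is a \<open>pair_graph\<close>: finite, loop-free, with a symmetric set of
  arcs that are pairs of vertices. The notions below are stated for arbitrary
  \<open>pre_digraph\<close>s; they apply to a \<open>pair_graph\<close> through the coercion \<open>with_proj\<close>.
\<close>

text \<open>
  The length of a shortest path. The value is only meaningful when \<open>y\<close> is reachable from \<open>x\<close>,
  which always holds for vertices of a connected graph.
\<close>
definition graph_dist :: "('a, 'b) pre_digraph \<Rightarrow> 'a \<Rightarrow> 'a \<Rightarrow> nat" where
  "graph_dist G x y = (LEAST n. \<exists>p. pre_digraph.apath G x p y \<and> length p = n)"

definition graph_dist_upto :: "nat \<Rightarrow> ('a, 'b) pre_digraph \<Rightarrow> 'a \<Rightarrow> 'a \<Rightarrow> nat" where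
  "graph_dist_upto k G x y = min (graph_dist G x y) (k + 1)"

definition distance_dominating :: "nat \<Rightarrow> ('a, 'b) pre_digraph \<Rightarrow> 'a set \<Rightarrow> bool" where
  "distance_dominating k G D \<longleftrightarrow>
     D \<subseteq> verts G \<and> (\<forall>u \<in> verts G - D. \<exists>w \<in> D. graph_dist G u w \<le> k)"

definition distance_domination_number :: "nat \<Rightarrow> ('a, 'b) pre_digraph \<Rightarrow> nat" where
  "distance_domination_number k G = (LEAST n. \<exists>D. distance_dominating k G D \<and> card D = n)"

definition distance_resolving :: "nat \<Rightarrow> ('a, 'b) pre_digraph \<Rightarrow> 'a set \<Rightarrow> bool" where
  "distance_resolving k G S \<longleftrightarrow>
     S \<subseteq> verts G \<and>
     (\<forall>x \<in> verts G. \<forall>y \<in> verts G. x \<noteq> y \<longrightarrow>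
        (\<exists>z \<in> S. graph_dist_upto k G x z \<noteq> graph_dist_upto k G y z))"

definition distance_dimension :: "nat \<Rightarrow> ('a, 'b) pre_digraph \<Rightarrow> nat" where
  "distance_dimension k G = (LEAST n. \<exists>S. distance_resolving k G S \<and> card S = n)"

end

theory Submission
  imports Defs
begin

text \<open>
  Attach a path with \<open>k + 1\<close> vertices to each vertex of a triangle (the vertices of the triangle
  count as path vertices). The three leaves are pairwise at distance \<open>2 * k + 1\<close>, so no vertex is
  within distance \<open>k\<close> of two of them and three vertices are needed to dominate; the triangle
  suffices. Two vertices of the triangle resolve: a vertex at depth \<open>t \<le> k\<close> has distances
  \<open>(t, t + 1)\<close>, \<open>(t + 1, t)\<close> or \<open>(t + 1, t + 1)\<close> to them, none of which
  is affected by truncation at \<open>k + 1\<close>. A single vertex separates at most \<open>k + 2 < 3 * (k + 1)\<close>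
  vertices.
\<close>

text \<open>Taking arcs along which \<open>d\<close> drops by exactly one ends at \<open>w\<close>
  after \<open>d u\<close> steps. Besides bounding distances from above, this gives
  reachability.\<close>

lemma (in wf_digraph) awalk_of_descent:
  assumes "u \<in> verts G"
    and "\<And>x. x \<in> verts G \<Longrightarrow> d x = 0 \<Longrightarrow> x = w"
    and "\<And>x. x \<in> verts G \<Longrightarrow> d x > 0 \<Longrightarrow> \<exists>e \<in> arcs G. tail G e = x \<and> d x = Suc (d (head G e))"
  shows "\<exists>p. awalk u p w \<and> length p = d u"
  using assms(1)
proof (induction "d u" arbitrary: u)
  case 0
  then show ?case using assms(2) by (intro exI[of _ "[]"]) (auto simp: awalk_Nil_iff)
next
  case (Suc n)
  then obtain e where e: "e \<in> arcs G" "tail G e = u" "d u = Suc (d (head G e))"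
    using assms(3)[of u] by auto
  then obtain p where "awalk (head G e) p w" "length p = d (head G e)"
    using Suc by (metis Suc_inject head_in_verts)
  with e show ?case by (intro exI[of _ "e # p"]) (auto simp: awalk_Cons_iff)
qed

text \<open>Each arc lowers \<open>d\<close> by at most one, so the drops along the walk
  telescope.\<close>

lemma (in wf_digraph) potential_le_length_awalk:
  fixes d :: "'a \<Rightarrow> nat"
  assumes "awalk u p w" "d w = 0"
    and "\<And>e. e \<in> arcs G \<Longrightarrow> d (tail G e) \<le> Suc (d (head G e))"
  shows "d u \<le> length p"
  using assms(1)
proof (induction p arbitrary: u)
  case Nil
  then show ?case using assms(2) by (simp add: awalk_Nil_iff)
next
  case (Cons e p)
  then have "d (head G e) \<le> length p" "e \<in> arcs G" "tail G e = u"
    by (auto simp: awalk_Cons_iff)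
  then show ?case using assms(3)[of e] by simp
qed

text \<open>\<open>graph_dist\<close> minimises over paths, whereas descent yields only a walk;
  cutting out closed subwalks never lengthens it.\<close>

lemma (in wf_digraph) length_awalk_to_apath_le:
  assumes "awalk u p v"
  shows "length (awalk_to_apath p) \<le> length p"
  using assms
proof (induct rule: awalk_to_apath_induct)
  case (path p)
  then have "awalk_to_apath p = p" by (auto simp: awalk_to_apath.simps)
  then show ?case by simp
next
  case (decomp p q r s)
  have "p = q @ r @ s" using decomp(1-3) by (auto elim!: awalk_cyc_decompE)
  moreover have "awalk_to_apath p = awalk_to_apath (q @ s)"
    using step_awalk_to_apath decomp(1-3) by blast
  ultimately show ?case using decomp(4) by simp
qed

text \<open>A potential \<open>d\<close> certifies distances to \<open>w\<close>:
  \<open>step\<close> bounds every path from below, and \<open>descent\<close> supplies a walk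
  attaining the bound.\<close>

lemma (in wf_digraph) graph_dist_eqI:
  assumes "u \<in> verts G" "w \<in> verts G"
    and zero: "\<And>x. x \<in> verts G \<Longrightarrow> d x = 0 \<longleftrightarrow> x = w"
    and step: "\<And>e. e \<in> arcs G \<Longrightarrow> d (tail G e) \<le> Suc (d (head G e))"
    and descent: "\<And>x. x \<in> verts G \<Longrightarrow> d x > 0 \<Longrightarrow>
      \<exists>e \<in> arcs G. tail G e = x \<and> d x = Suc (d (head G e))"
  shows "graph_dist G u w = d u"
proof -
  have le: "d u \<le> length p" if "apath u p w" for p
    using potential_le_length_awalk[of u p w d] that step zero[OF assms(2)]
    by (auto simp: apath_def)
  obtain p where p: "awalk u p w" "length p = d u"
    using awalk_of_descent[of u d w] assms(1) zero descent by blast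
  have q: "apath u (awalk_to_apath p) w" by (rule apath_awalk_to_apath[OF p(1)])
  have "length (awalk_to_apath p) = d u"
    using le[OF q] length_awalk_to_apath_le[OF p(1)] p(2) by simp
  then show ?thesis
    unfolding graph_dist_def using q le by (intro Least_equality) auto
qed

text \<open>The truncated distances to \<open>S\<close> determine a vertex, and each takes one of
  the \<open>k + 2\<close> values up to \<open>k + 1\<close>.\<close>

lemma card_verts_le_resolving:
  assumes "finite (verts G)" "distance_resolving k G S"
  shows "card (verts G) \<le> (k + 2) ^ card S"
proof -
  \<comment> \<open>Restricting to \<open>S\<close> puts the image into an extensional function
    space, whose cardinality is the desired power.\<close>
  let ?f = "\<lambda>x. \<lambda>z\<in>S. graph_dist_upto k G x z"
  have fin: "finite S"
    using assms finite_subset by (auto simp: distance_resolving_def)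
  have "inj_on ?f (verts G)"
    using assms(2) by (force simp: inj_on_def distance_resolving_def dest: fun_cong split: if_splits)
  moreover have "?f ` verts G \<subseteq> S \<rightarrow>\<^sub>E {..<k + 2}"
    by (auto simp: graph_dist_upto_def)
  ultimately have "card (verts G) \<le> card (S \<rightarrow>\<^sub>E {..<k + 2})"
    using fin by (intro card_inj_on_le[of ?f]) (auto intro: finite_PiE)
  then show ?thesis using fin by (simp add: card_PiE)
qed

text \<open>The vertex \<open>n\<close> lies on leg \<open>n mod 3\<close> at depth \<open>n div 3\<close>; the triangle is \<open>{0, 1, 2}\<close>.\<close>

definition leg_dist :: "nat \<Rightarrow> nat \<Rightarrow> nat" where
  "leg_dist u v = (if u mod 3 = v mod 3 then (u div 3 - v div 3) + (v div 3 - u div 3)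
                   else u div 3 + v div 3 + 1)"

text \<open>Adjacency is read off the intended metric: \<open>leg_dist u v = 1\<close> means
  consecutive depths on one leg, or two distinct triangle vertices.\<close>

definition legged_triangle :: "nat \<Rightarrow> nat pair_pre_digraph" where
  "legged_triangle k =
     \<lparr> pverts = {..<3 * (k + 1)},
       parcs = {(u, v). u < 3 * (k + 1) \<and> v < 3 * (k + 1) \<and> leg_dist u v = 1} \<rparr>"

lemma pverts_legged_triangle [simp]: "pverts (legged_triangle k) = {..<3 * (k + 1)}"
  and parcs_legged_triangle: "parcs (legged_triangle k) =
    {(u, v). u < 3 * (k + 1) \<and> v < 3 * (k + 1) \<and> leg_dist u v = 1}"
  by (simp_all add: legged_triangle_def)

lemma leg_dist_commute: "leg_dist u v = leg_dist v u"
  by (simp add: leg_dist_def)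

lemma leg_dist_eq_0_iff: "leg_dist u v = 0 \<longleftrightarrow> u = v"
proof
  assume "leg_dist u v = 0"
  then have "u mod 3 = v mod 3" "u div 3 = v div 3" by (auto simp: leg_dist_def split: if_splits)
  then show "u = v" by (metis div_mult_mod_eq)
qed (simp add: leg_dist_def)

lemma leg_dist_triangle: "leg_dist u w \<le> leg_dist u v + leg_dist v w"
  \<comment> \<open>At least one of the two truncated differences on a common leg is 0, so their sum
    is the absolute difference of depths.\<close>
  by (auto simp: leg_dist_def split: nat_diff_split)

text \<open>Move outwards if \<open>w\<close> lies further out on the same leg, otherwise inwards,
  and at depth 0 cross the triangle to the foot \<open>w mod 3\<close> of the leg of
  \<open>w\<close>.\<close>

lemma leg_dist_descent:
  assumes "u < 3 * (k + 1)" "w < 3 * (k + 1)" "leg_dist u w > 0"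
  shows "\<exists>v < 3 * (k + 1). leg_dist u v = 1 \<and> leg_dist u w = Suc (leg_dist v w)"
proof -
  have "u mod 3 \<noteq> w mod 3 \<or> u div 3 \<noteq> w div 3"
    using assms(3) by (auto simp: leg_dist_def)
  then consider (down) "u mod 3 = w mod 3" "u div 3 < w div 3"
    | (up) "u div 3 > 0" "u mod 3 \<noteq> w mod 3 \<or> u div 3 > w div 3"
    | (cross) "u div 3 = 0" "u mod 3 \<noteq> w mod 3"
    by (metis gr0I linorder_neqE_nat not_less_zero)
  then show ?thesis
  proof cases
    case down
    moreover from this have "u + 3 < 3 * (k + 1)"
      using assms(2) div_mult_mod_eq[of u 3] div_mult_mod_eq[of w 3] by linarith
    ultimately show ?thesis by (intro exI[of _ "u + 3"]) (auto simp: leg_dist_def Suc_diff_Suc)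
  next
    case up
    then obtain v where "u = v + 3"
      by (metis add.commute div_greater_zero_iff le_Suc_ex)
    with up assms show ?thesis by (intro exI[of _ v]) (auto simp: leg_dist_def Suc_diff_le)
  next
    case cross
    moreover have "w mod 3 < 3 * (k + 1)" by (rule less_le_trans[of _ 3]) simp_all
    ultimately show ?thesis by (intro exI[of _ "w mod 3"]) (auto simp: leg_dist_def)
  qed
qed

lemma pair_graph_legged_triangle: "pair_graph (legged_triangle k)"
proof
  show "finite (parcs (legged_triangle k))"
    by (rule finite_subset[of _ "{..<3 * (k + 1)} \<times> {..<3 * (k + 1)}"])
      (auto simp: parcs_legged_triangle)
  show "symmetric (legged_triangle k)"
    by (auto simp: symmetric_def parcs_legged_triangle leg_dist_commute intro: symI)
qed (auto simp: parcs_legged_triangle leg_dist_def)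

lemma legged_triangle_arc_descent:
  assumes "u < 3 * (k + 1)" "w < 3 * (k + 1)" "leg_dist u w > 0"
  shows "\<exists>e \<in> parcs (legged_triangle k). fst e = u \<and> leg_dist u w = Suc (leg_dist (snd e) w)"
  using leg_dist_descent[OF assms] assms(1) by (force simp: parcs_legged_triangle)

lemma graph_dist_legged_triangle:
  assumes "u < 3 * (k + 1)" "w < 3 * (k + 1)"
  shows "graph_dist (legged_triangle k) u w = leg_dist u w"
proof -
  interpret pair_graph "legged_triangle k" by (rule pair_graph_legged_triangle)
  have "leg_dist (fst e) w \<le> Suc (leg_dist (snd e) w)" if "e \<in> parcs (legged_triangle k)" for e
    using that leg_dist_triangle[of "fst e" w "snd e"] by (auto simp: parcs_legged_triangle)
  then show ?thesis
    using assms legged_triangle_arc_descent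
    by (intro graph_dist_eqI[where d = "\<lambda>x. leg_dist x w"]) (auto simp: leg_dist_eq_0_iff)
qed

lemma connected_legged_triangle: "connected (legged_triangle k)"
proof -
  interpret pair_graph "legged_triangle k" by (rule pair_graph_legged_triangle)
  have "u \<rightarrow>\<^sup>*\<^bsub>legged_triangle k\<^esub> w" if "u < 3 * (k + 1)" "w < 3 * (k + 1)" for u w
    using awalk_of_descent[of u "\<lambda>x. leg_dist x w" w] that legged_triangle_arc_descent
    by (auto simp: leg_dist_eq_0_iff reachable_awalk)
  then show ?thesis
    \<comment> \<open>\<open>connected\<close> speaks of the symmetric closure, so reachability is
      transferred there.\<close>
    using reachable_mk_symmetricI by (intro connectedI) (simp_all add: lessThan_empty_iff)
qed

lemma distance_domination_number_legged_triangle: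
  "distance_domination_number k (legged_triangle k) = 3"
  unfolding distance_domination_number_def
proof (rule Least_equality)
  have "\<exists>w \<in> {0, 1, 2}. graph_dist (legged_triangle k) u w \<le> k" if "u < 3 * (k + 1)" for u
  proof -
    have "u div 3 \<le> k" using that by presburger
    \<comment> \<open>\<open>u mod 3\<close> is the triangle vertex on the leg of
      \<open>u\<close>.\<close>
    then have "leg_dist u (u mod 3) \<le> k" by (simp add: leg_dist_def)
    moreover have "u mod 3 \<in> {0, 1, 2}" by auto
    ultimately show ?thesis using that by (metis graph_dist_legged_triangle mod_less_divisor
        add_gr_0 less_le_trans le_add2 mult_le_mono2 mult.right_neutral zero_less_numeral)
  qed
  then have "distance_dominating k (legged_triangle k) {0, 1, 2}"
    by (auto simp: distance_dominating_def)
  moreover have "card {0, 1, 2 :: nat} = 3" by simp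
  ultimately show "\<exists>D. distance_dominating k (legged_triangle k) D \<and> card D = 3" by blast
next
  fix n assume "\<exists>D. distance_dominating k (legged_triangle k) D \<and> card D = n"
  then obtain D where D: "D \<subseteq> {..<3 * (k + 1)}" "card D = n"
    "\<And>u. u < 3 * (k + 1) \<Longrightarrow> u \<notin> D \<Longrightarrow> \<exists>w\<in>D. graph_dist (legged_triangle k) u w \<le> k"
    by (auto simp: distance_dominating_def)
  have "\<exists>w\<in>D. leg_dist u w \<le> k" if "u < 3 * (k + 1)" for u
  proof (cases "u \<in> D")
    case True
    then show ?thesis by (intro bexI[of _ u]) (auto simp: leg_dist_def)
  next
    case False
    then show ?thesis using D(1) D(3)[OF that] that graph_dist_legged_triangle by fastforce
  qed
  \<comment> \<open>Members of \<open>D\<close> are within distance 0 of themselves, so a dominator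
    can be chosen for every vertex; on the leaves \<open>?L\<close> this choice will be
    injective.\<close>
  then obtain f where f: "\<And>u. u < 3 * (k + 1) \<Longrightarrow> f u \<in> D \<and> leg_dist u (f u) \<le> k"
    by metis
  let ?L = "{3 * k, 3 * k + 1, 3 * k + 2}"
  have far: "u = v" if "u \<in> ?L" "v \<in> ?L" "leg_dist u w \<le> k" "leg_dist v w \<le> k" for u v w
  proof -
    have "leg_dist u v \<le> 2 * k"
      using leg_dist_triangle[of u v w] that(3,4) leg_dist_commute[of w v] by linarith
    moreover have depth: "u div 3 = k" "v div 3 = k" using that(1,2) by auto
    ultimately have "u mod 3 = v mod 3"
      unfolding leg_dist_def depth by (cases "u mod 3 = v mod 3") simp_all
    with depth show ?thesis using div_mult_mod_eq[of u 3] div_mult_mod_eq[of v 3] by simp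
  qed
  have "inj_on f ?L"
  proof (rule inj_onI)
    fix u v assume uv: "u \<in> ?L" "v \<in> ?L" "f u = f v"
    then have "u < 3 * (k + 1)" "v < 3 * (k + 1)" by auto
    with uv f show "u = v" by (metis far)
  qed
  moreover have "f ` ?L \<subseteq> D" using f by auto
  ultimately have "card ?L \<le> card D"
    using D(1) finite_subset by (intro card_inj_on_le) auto
  then show "3 \<le> n" using D(2) by simp
qed

lemma distance_dimension_legged_triangle:
  "distance_dimension k (legged_triangle k) = 2"
  unfolding distance_dimension_def
proof (rule Least_equality)
  have "x = y" if xy: "x < 3 * (k + 1)" "y < 3 * (k + 1)"
    and eq: "\<And>z. z \<in> {0, 1} \<Longrightarrow>
      graph_dist_upto k (legged_triangle k) x z = graph_dist_upto k (legged_triangle k) y z"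
    for x y
  proof -
    have depth: "x div 3 \<le> k" "y div 3 \<le> k" using xy by presburger+
    have "leg_dist x z = leg_dist y z" if "z \<in> {0, 1}" for z
    proof -
      have "leg_dist x z \<le> k + 1" "leg_dist y z \<le> k + 1"
        using depth that by (auto simp: leg_dist_def)
      moreover have "z < 3 * (k + 1)" using that by auto
      ultimately show ?thesis
        using eq[OF that] xy graph_dist_legged_triangle by (simp add: graph_dist_upto_def)
    qed
    then have eqs: "leg_dist x 0 = leg_dist y 0" "leg_dist x 1 = leg_dist y 1" by auto
    have "x mod 3 = 0 \<or> x mod 3 = 1 \<or> x mod 3 = 2" "y mod 3 = 0 \<or> y mod 3 = 1 \<or> y mod 3 = 2"
      by linarith+
    \<comment> \<open>The difference of the distances to 0 and 1 reveals the leg; either distance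
      then gives the depth.\<close>
    then have "x mod 3 = y mod 3 \<and> x div 3 = y div 3"
      using eqs by (auto simp: leg_dist_def)
    then show ?thesis by (metis div_mult_mod_eq)
  qed
  then have "distance_resolving k (legged_triangle k) {0, 1}"
    unfolding distance_resolving_def by fastforce
  moreover have "card {0, 1 :: nat} = 2" by simp
  ultimately show "\<exists>S. distance_resolving k (legged_triangle k) S \<and> card S = 2" by blast
next
  fix n assume "\<exists>S. distance_resolving k (legged_triangle k) S \<and> card S = n"
  then have "3 * (k + 1) \<le> (k + 2) ^ n"
    using card_verts_le_resolving[of "with_proj (legged_triangle k)" k] by auto
  \<comment> \<open>Monotonicity treats \<open>n = 0\<close> and \<open>n = 1\<close> together, and
    \<open>k + 2 < 3 * (k + 1)\<close> contradicts the counting bound.\<close>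
  moreover have "(k + 2) ^ n \<le> (k + 2) ^ 1" if "n \<le> 1"
    using that by (intro power_increasing) auto
  ultimately show "2 \<le> n" by (cases "n \<le> 1") auto
qed

theorem mainTheorem2:
  fixes k :: nat
  assumes "k \<ge> 1"
  shows "\<exists>G :: nat pair_pre_digraph.
           pair_graph G \<and> connected (with_proj G) \<and> card (pverts G) \<ge> 2 \<and>
           distance_domination_number k (with_proj G) = distance_dimension k (with_proj G) + 1"
  using pair_graph_legged_triangle[of k] connected_legged_triangle[of k]
  by (intro exI[of _ "legged_triangle k"])
    (simp add: distance_domination_number_legged_triangle distance_dimension_legged_triangle)

end
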